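(* (Generalized Imhof relation, with wall restriction.) Let $N\ge1$ and $\ell\ge1$ be integers, $T>0$, and $0=t_0<t_1<\cdots<t_\ell=T$. Then for all $\mathbf{y}_1,\dots,\mathbf{y}_\ell\in\mathbf{R}^N$ each having coordinates satisfying $0<y_1<y_2<\cdots<y_N$, with $\mathbf{y}_0=\mathbf{0}$, $$\prod_{i=1}^{\ell}\widehat{g}_N^T(t_{i-1},\mathbf{y}_{i-1},t_i,\mathbf{y}_i)=\widetilde{c}_N\,T^{N^2/2}\left(\prod_{i=1}^{\ell}\widehat{p}_N(t_{i-1},\mathbf{y}_{i-1},t_i,\mathbf{y}_i)\right)\frac{1}{\widehat{h}_N(\mathbf{y}_\ell)},$$ where $$\widetilde{c}_N=\left(\frac{\pi}{2}\right)^{N/2}\prod_{j=1}^N\frac{\Gamma(2j)}{\Gamma(j)}.$$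
   Context: $\mathbf{R}^N_{+,<}=\{\mathbf{x}\in\mathbf{R}^N:0\le x_1<x_2<\cdots<x_N\}$ and $\widehat{h}_N(\mathbf{x})=\prod_{1\le i<j\le N}(x_j^2-x_i^2)\prod_{i=1}^Nx_i$. For $t>0$, $\mathbf{x},\mathbf{y}\in\mathbf{R}^N_{+,<}$, $$\widehat{f}_N(t,\mathbf{y}|\mathbf{x})=\det_{1\le i,j\le N}\left((2\pi t)^{-1/2}\left(e^{-(x_j-y_i)^2/2t}-e^{-(x_j+y_i)^2/2t}\right)\right),\qquad\widehat{\mathcal{N}}_N(t,\mathbf{x})=\int_{\mathbf{R}^N_{+,<}}\widehat{f}_N(t,\mathbf{y}|\mathbf{x})\,d\mathbf{y},$$ and $\widehat{\mathcal{N}}_N(0,\mathbf{x})=1$ when $0<x_1<\cdots<x_N$. The densities $\widehat{g}_N^T$ (for $0\le s<t\le T$) and $\widehat{p}_N$ (for $0\le s<t<\infty$), with $0<x_1<\cdots<x_N$ and $0<y_1<\cdots<y_N$, are $$\widehat{g}_N^T(0,\mathbf{0},t,\mathbf{y})=\widehat{c}_NT^{N^2/2}t^{-N(2N+1)/2}e^{-|\mathbf{y}|^2/2t}\widehat{h}_N(\mathbf{y})\widehat{\mathcal{N}}_N(T-t,\mathbf{y}),\qquad\widehat{g}_N^T(s,\mathbf{x},t,\mathbf{y})=\frac{\widehat{f}_N(t-s,\mathbf{y}|\mathbf{x})\widehat{\mathcal{N}}_N(T-t,\mathbf{y})}{\widehat{\mathcal{N}}_N(T-s,\mathbf{x})},$$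 $$\widehat{p}_N(0,\mathbf{0},t,\mathbf{y})=\widehat{c'}_Nt^{-N(2N+1)/2}e^{-|\mathbf{y}|^2/2t}\widehat{h}_N(\mathbf{y})^2,\qquad\widehat{p}_N(s,\mathbf{x},t,\mathbf{y})=\frac{1}{\widehat{h}_N(\mathbf{x})}\widehat{f}_N(t-s,\mathbf{y}|\mathbf{x})\widehat{h}_N(\mathbf{y}),$$ where $\widehat{c}_N=1/\prod_{j=1}^N\Gamma(j)$ and $\widehat{c'}_N=(2/\pi)^{N/2}/\prod_{j=1}^N\Gamma(2j)$. *)

theory Defs
  imports "HOL-Analysis.Analysis" "Jordan_Normal_Form.Determinant"
begin

text \<open>
  A point of \<open>\<real>\<^sup>N\<close> is represented by a function \<open>x :: nat \<Rightarrow> real\<close> of which only the values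
  on \<open>{..<N}\<close> matter; the coordinate written \<open>x\<^sub>i\<close> for \<open>1 \<le> i \<le> N\<close> is \<open>x (i - 1)\<close>.
\<close>

definition chamber :: "nat \<Rightarrow> (nat \<Rightarrow> real) set" where
  "chamber N = {x. (\<forall>i<N. 0 \<le> x i) \<and> strict_mono_on {..<N} x}"

definition open_chamber :: "nat \<Rightarrow> (nat \<Rightarrow> real) set" where
  "open_chamber N = {x. (\<forall>i<N. 0 < x i) \<and> strict_mono_on {..<N} x}"

definition norm_sq :: "nat \<Rightarrow> (nat \<Rightarrow> real) \<Rightarrow> real" where
  "norm_sq N x = (\<Sum>i<N. (x i)\<^sup>2)"

definition h_hat :: "nat \<Rightarrow> (nat \<Rightarrow> real) \<Rightarrow> real" where
  "h_hat N x = (\<Prod>j<N. \<Prod>i<j. (x j)\<^sup>2 - (x i)\<^sup>2) * (\<Prod>i<N. x i)"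

text \<open>The arguments are in the order \<open>t\<close>, \<open>y\<close>, \<open>x\<close> of the notation \<open>f(t, y | x)\<close>.\<close>

definition f_hat :: "nat \<Rightarrow> real \<Rightarrow> (nat \<Rightarrow> real) \<Rightarrow> (nat \<Rightarrow> real) \<Rightarrow> real" where
  "f_hat N t y x = Determinant.det (mat N N (\<lambda>(i, j).
     (2 * pi * t) powr (- 1 / 2) *
       (exp (- (x j - y i)\<^sup>2 / (2 * t)) - exp (- (x j + y i)\<^sup>2 / (2 * t)))))"

text \<open>The value at \<open>t = 0\<close> is a convention, relevant only for \<open>x\<close> in the open chamber.\<close>

definition N_hat :: "nat \<Rightarrow> real \<Rightarrow> (nat \<Rightarrow> real) \<Rightarrow> real" where
  "N_hat N t x =
     (if t = 0 then 1
      else (LINT y : chamber N | Pi\<^sub>M {..<N} (\<lambda>_. lborel). f_hat N t y x))"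

definition c_hat :: "nat \<Rightarrow> real" where
  "c_hat N = 1 / (\<Prod>j=1..N. Gamma (real j))"

definition c_hat' :: "nat \<Rightarrow> real" where
  "c_hat' N = (2 / pi) powr (real N / 2) / (\<Prod>j=1..N. Gamma (2 * real j))"

definition c_tilde :: "nat \<Rightarrow> real" where
  "c_tilde N = (pi / 2) powr (real N / 2) * (\<Prod>j=1..N. Gamma (2 * real j) / Gamma (real j))"

text \<open>
  The first branch of the two transition densities is the start at the origin at time \<open>0\<close>;
  it does not overlap with starts \<open>x\<close> in the open chamber when \<open>N \<ge> 1\<close>.
\<close>

definition g_hat ::
  "nat \<Rightarrow> real \<Rightarrow> real \<Rightarrow> (nat \<Rightarrow> real) \<Rightarrow> real \<Rightarrow> (nat \<Rightarrow> real) \<Rightarrow> real" where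
  "g_hat N T s x t y =
     (if s = 0 \<and> (\<forall>i<N. x i = 0)
      then c_hat N * T powr ((real N)\<^sup>2 / 2) * t powr (- (real N * (2 * real N + 1) / 2)) *
             exp (- norm_sq N y / (2 * t)) * h_hat N y * N_hat N (T - t) y
      else f_hat N (t - s) y x * N_hat N (T - t) y / N_hat N (T - s) x)"

definition p_hat ::
  "nat \<Rightarrow> real \<Rightarrow> (nat \<Rightarrow> real) \<Rightarrow> real \<Rightarrow> (nat \<Rightarrow> real) \<Rightarrow> real" where
  "p_hat N s x t y =
     (if s = 0 \<and> (\<forall>i<N. x i = 0)
      then c_hat' N * t powr (- (real N * (2 * real N + 1) / 2)) *
             exp (- norm_sq N y / (2 * t)) * (h_hat N y)\<^sup>2
      else 1 / h_hat N x * f_hat N (t - s) y x * h_hat N y)"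

end

theory Submission imports Defs "HOL-Probability.Distributions" begin

text \<open>
  Everything telescopes once \<open>N_hat N s x \<noteq> 0\<close> is known for \<open>x\<close> in the open chamber and \<open>s > 0\<close>
  (a vanishing \<open>N_hat\<close> would be divided by). Up to Gaussian factors \<open>f_hat\<close> is
  \<open>det (sinh (x\<^sub>j y\<^sub>i / s))\<close>. A zero of this determinant gives a nontrivial sum
  \<open>\<Sum>j. c\<^sub>j sinh (x\<^sub>j y / s)\<close>, i.e. an exponential sum with \<open>2N\<close> frequencies, with the \<open>2N\<close> zeros
  \<open>\<plusminus>y\<^sub>i\<close>, which Rolle's theorem excludes. So \<open>f_hat\<close> has no zero in the convex open chamber, hence
  constant sign there, and its integral cannot vanish.
\<close>

section \<open>Zeros of real exponential sums\<close>

lemma Rolle_finite_zeros: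
  fixes f f' :: "real \<Rightarrow> real"
  assumes "finite Z" and "\<And>z. z \<in> Z \<Longrightarrow> f z = 0"
    and deriv: "\<And>z. (f has_real_derivative f' z) (at z)"
  obtains Z' where "finite Z'" "card Z' = card Z - 1" "\<And>z. z \<in> Z' \<Longrightarrow> f' z = 0"
proof -
  \<comment> \<open>The clause \<open>z < u\<close> strengthens the induction: earlier zeros of
    \<open>f'\<close> stay below \<open>Max A\<close>, so the one found between \<open>Max A\<close>
    and the new maximum \<open>b\<close> is distinct from them.\<close>
  have "\<exists>Z'. finite Z' \<and> card Z' = card Z - 1 \<and> (\<forall>z\<in>Z'. f' z = 0 \<and> (\<exists>u\<in>Z. z < u))"
    using assms(1,2)
  proof (induction Z rule: finite_linorder_max_induct)
    case empty
    then show ?case by auto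
  next
    case (insert b A)
    show ?case
    proof (cases "A = {}")
      case True
      then show ?thesis by (intro exI[of _ "{}"]) auto
    next
      case False
      from insert.IH insert.prems obtain Z' where Z': "finite Z'" "card Z' = card A - 1"
        "\<forall>z\<in>Z'. f' z = 0 \<and> (\<exists>u\<in>A. z < u)" by auto
      have max: "Max A \<in> A" using False insert.hyps by simp
      have lt: "Max A < b" using max insert.hyps by blast
      have "\<exists>z. Max A < z \<and> z < b \<and> (\<lambda>h. f' z * h) = (\<lambda>v. 0)"
      proof (rule Rolle_deriv[OF lt])
        show "f (Max A) = f b" using insert.prems max by simp
        show "continuous_on {Max A..b} f"
          using deriv by (meson DERIV_isCont continuous_at_imp_continuous_on)
        show "(f has_derivative (\<lambda>h. f' z * h)) (at z)" for z
          using deriv[of z] by (simp add: has_field_derivative_def)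
      qed
      then obtain z where z: "Max A < z" "z < b" "f' z = 0"
        by (metis mult.right_neutral)
      have "z \<notin> Z'"
      proof
        assume "z \<in> Z'"
        then obtain u where "u \<in> A" "z < u" using Z' by blast
        moreover have "u \<le> Max A" using \<open>u \<in> A\<close> insert.hyps by simp
        ultimately show False using z by simp
      qed
      moreover have "card A > 0" using False insert.hyps by (simp add: card_gt_0_iff)
      moreover have "b \<notin> A" using insert.hyps by blast
      ultimately show ?thesis using Z' z insert.hyps
        by (intro exI[of _ "insert z Z'"]) auto
    qed
  qed
  then show thesis using that by blast
qed

text \<open>Dividing by one exponential makes its term constant, and differentiating then removes
  it. Rolle costs only one zero, so terms and zeros decrease together; the other coefficients are
  merely scaled by nonzero differences of frequencies.\<close>

lemma exp_sum_zeros_imp_zero: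
  fixes a c :: "'i \<Rightarrow> real"
  assumes "finite I" "inj_on a I" "finite Z" "card Z \<ge> card I"
    and "\<And>z. z \<in> Z \<Longrightarrow> (\<Sum>i\<in>I. c i * exp (a i * z)) = 0"
  shows "\<forall>i\<in>I. c i = 0"
  using assms
proof (induction I arbitrary: c Z rule: finite_induct)
  case empty
  then show ?case by simp
next
  case (insert b I)
  define F where "F z = (\<Sum>i\<in>insert b I. c i * exp ((a i - a b) * z))" for z
  define F' where "F' z = (\<Sum>i\<in>insert b I. c i * (exp ((a i - a b) * z) * (a i - a b)))" for z
  have F: "F z = exp (- a b * z) * (\<Sum>i\<in>insert b I. c i * exp (a i * z))" for z
    unfolding F_def sum_distrib_left
    by (intro sum.cong refl) (simp add: exp_add[symmetric] algebra_simps exp_diff exp_minus field_simps)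
  have F0: "F z = 0" if "z \<in> Z" for z
    unfolding F insert.prems(4)[OF that] by simp
  have dF: "(F has_real_derivative F' z) (at z)" for z
    unfolding F_def[abs_def] F'_def
    by (intro derivative_eq_intros DERIV_sum | simp)+
  obtain Z' where Z': "finite Z'" "card Z' = card Z - 1" "\<And>z. z \<in> Z' \<Longrightarrow> F' z = 0"
    using Rolle_finite_zeros[OF insert.prems(2) F0 dF] by blast
  have F'0: "(\<Sum>i\<in>I. c i * (a i - a b) * exp (a i * z)) = 0" if "z \<in> Z'" for z
  proof -
    have "(\<Sum>i\<in>I. c i * (a i - a b) * exp (a i * z)) = exp (a b * z) * F' z"
    proof -
      have "c i * (a i - a b) * exp (a i * z) =
        exp (a b * z) * (c i * (exp ((a i - a b) * z) * (a i - a b)))" for i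
      proof -
        have "exp (a i * z) = exp (a b * z) * exp ((a i - a b) * z)"
          by (simp add: exp_add[symmetric] algebra_simps)
        then show ?thesis by (simp only: mult_ac)
      qed
      moreover have "F' z = (\<Sum>i\<in>I. c i * (exp ((a i - a b) * z) * (a i - a b)))"
        using insert.hyps by (simp add: F'_def)
      ultimately show ?thesis by (simp only: sum_distrib_left)
    qed
    then show ?thesis using Z'(3)[OF that] by simp
  qed
  have "\<forall>i\<in>I. c i * (a i - a b) = 0"
    using insert.prems insert.hyps Z' F'0
    by (intro insert.IH[where Z = Z']) auto
  moreover have "a i \<noteq> a b" if "i \<in> I" for i
    using that insert.prems(1) insert.hyps by (auto simp: inj_on_def)
  ultimately have cI: "\<forall>i\<in>I. c i = 0" by simp
  \<comment> \<open>With the other coefficients gone, a single zero of the original sum forces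
    \<open>c b = 0\<close>.\<close>
  have "card Z > 0" using insert.prems insert.hyps by simp
  then obtain z where "z \<in> Z" by (auto simp: card_gt_0_iff)
  from insert.prems(4)[OF this] cI insert.hyps have "c b = 0" by simp
  with cI show ?case by simp
qed

section \<open>Nonvanishing and constant sign of \<open>f_hat\<close>\<close>

text \<open>Transition density of Brownian motion on the half-line killed at 0, in the form given by
  the reflection principle; these are the matrix entries of \<open>f_hat\<close>.\<close>

definition absorbing_kernel :: "real \<Rightarrow> real \<Rightarrow> real \<Rightarrow> real" where
  "absorbing_kernel t x y = (2 * pi * t) powr (- 1 / 2) *
     (exp (- (x - y)\<^sup>2 / (2 * t)) - exp (- (x + y)\<^sup>2 / (2 * t)))"

text \<open>Completing the squares separates a factor in \<open>y\<close> alone, a factor in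
  \<open>x\<close> alone, and twice \<open>sinh (x * y / t)\<close>.\<close>

lemma absorbing_kernel_exp:
  assumes "t > 0"
  shows "absorbing_kernel t x y = (2 * pi * t) powr (- 1 / 2) * exp (- y\<^sup>2 / (2 * t)) *
    (exp (- x\<^sup>2 / (2 * t)) * (exp (x / t * y) - exp (- (x / t) * y)))"
proof -
  have "- (x - y)\<^sup>2 / (2 * t) = - y\<^sup>2 / (2 * t) + (- x\<^sup>2 / (2 * t) + x / t * y)"
    and "- (x + y)\<^sup>2 / (2 * t) = - y\<^sup>2 / (2 * t) + (- x\<^sup>2 / (2 * t) + - (x / t) * y)"
    using assms by (auto simp: field_simps power2_eq_square)
  then show ?thesis
    unfolding absorbing_kernel_def by (simp only: exp_add) (simp add: algebra_simps)
qed

text \<open>In this form continuity in \<open>y\<close>, integrability and vanishing at the wall can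
  be read off from the products of one-variable kernels.\<close>

lemma f_hat_Leibniz:
  "f_hat N t y x = (\<Sum>p\<in>{p. p permutes {0..<N}}.
     signof p * (\<Prod>i<N. absorbing_kernel t (x (p i)) (y i)))"
proof -
  have "f_hat N t y x = (\<Sum>p\<in>{p. p permutes {0..<N}}.
     signof p * (\<Prod>i=0..<N. mat N N (\<lambda>(i, j). absorbing_kernel t (x j) (y i)) $$ (i, p i)))"
    unfolding f_hat_def absorbing_kernel_def[symmetric] Determinant.det_def by simp
  also have "\<dots> = (\<Sum>p\<in>{p. p permutes {0..<N}}.
     signof p * (\<Prod>i<N. absorbing_kernel t (x (p i)) (y i)))"
  proof (intro sum.cong refl arg_cong2[where f = "(*)"] prod.cong)
    show "{0..<N} = {..<N}" by auto
    fix p i assume "p \<in> {p. p permutes {0..<N}}" "i \<in> {..<N}"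
    then have "i < N" "p i < N" using permutes_in_image[of p "{0..<N}" i] by auto
    then show "mat N N (\<lambda>(i, j). absorbing_kernel t (x j) (y i)) $$ (i, p i)
      = absorbing_kernel t (x (p i)) (y i)" by simp
  qed
  finally show ?thesis .
qed

lemma f_hat_nonzero:
  assumes t: "t > 0" and x: "x \<in> open_chamber N" and y: "y \<in> open_chamber N"
  shows "f_hat N t y x \<noteq> 0"
proof
  assume 0: "f_hat N t y x = 0"
  define A where "A = mat N N (\<lambda>(i, j). absorbing_kernel t (x j) (y i))"
  have A: "A \<in> carrier_mat N N" by (simp add: A_def)
  have "Determinant.det A = 0" using 0 by (simp add: A_def f_hat_def absorbing_kernel_def)
  then obtain v where v: "v \<in> carrier_vec N" "v \<noteq> 0\<^sub>v N" "A *\<^sub>v v = 0\<^sub>v N"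
    using det_0_iff_vec_prod_zero[OF A] by auto
  \<comment> \<open>The Gaussian factor in \<open>x j\<close> is absorbed into the null vector; as
    it is positive, \<open>w\<close> vanishes only where \<open>v\<close> does.\<close>
  define w where "w j = exp (- (x j)\<^sup>2 / (2 * t)) * v $ j" for j
  have row: "(\<Sum>j<N. w j * (exp (x j / t * y i) - exp (- (x j / t) * y i))) = 0" if i: "i < N" for i
  proof -
    let ?C = "(2 * pi * t) powr (- 1 / 2) * exp (- (y i)\<^sup>2 / (2 * t))"
    have "0 = (A *\<^sub>v v) $ i" using v i by simp
    also have "\<dots> = (\<Sum>j<N. absorbing_kernel t (x j) (y i) * v $ j)"
      using i v(1) by (simp add: A_def scalar_prod_def lessThan_atLeast0)
    also have "\<dots> = ?C * (\<Sum>j<N. w j * (exp (x j / t * y i) - exp (- (x j / t) * y i)))"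
      by (simp only: absorbing_kernel_exp[OF t] w_def sum_distrib_left mult_ac)
    finally show ?thesis using t by simp
  qed
  \<comment> \<open>Each \<open>sinh\<close> splits into two exponentials, so the index carries a
    sign \<open>s\<close>, giving \<open>2 * N\<close> frequencies.\<close>
  let ?I = "{..<N} \<times> {1, -1 :: real}"
  define a where "a = (\<lambda>(j, s :: real). s * (x j / t))"
  define c where "c = (\<lambda>(j, s :: real). s * w j)"
  have inj_on_chamber: "inj_on u {..<N}" if "u \<in> open_chamber N" for u :: "nat \<Rightarrow> real"
    using that strict_mono_on_imp_inj_on by (auto simp: open_chamber_def)
  have xpos: "x j > 0" and ypos: "y j > 0" if "j < N" for j
    using x y that by (auto simp: open_chamber_def)
  have E: "(\<Sum>i\<in>?I. c i * exp (a i * z)) =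
    (\<Sum>j<N. w j * (exp (x j / t * z) - exp (- (x j / t) * z)))" for z
    unfolding a_def c_def
    by (subst sum.cartesian_product') (simp add: algebra_simps)
  \<comment> \<open>Oddness doubles the \<open>N\<close> zeros \<open>y i\<close> to
    \<open>2 * N\<close>, matching the number of frequencies.\<close>
  have E_odd: "(\<Sum>i\<in>?I. c i * exp (a i * - z)) = - (\<Sum>i\<in>?I. c i * exp (a i * z))" for z
    unfolding E sum_negf[symmetric] by (intro sum.cong refl) (simp add: algebra_simps)
  let ?Y = "y ` {..<N}"
  have "\<forall>i\<in>?I. c i = 0"
  proof (rule exp_sum_zeros_imp_zero[where a = a and Z = "?Y \<union> uminus ` ?Y"])
    show "inj_on a ?I"
    proof -
      have "x j / t \<noteq> - (x k / t)" "- x j \<noteq> x k" if "j < N" "k < N" for j k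
        using divide_pos_pos[OF xpos t, OF that(1)] divide_pos_pos[OF xpos t, OF that(2)]
          xpos[OF that(1)] xpos[OF that(2)] by linarith+
      then show ?thesis
        using inj_on_chamber[OF x] t by (auto simp: a_def inj_on_def)
    qed
    have "?Y \<inter> uminus ` ?Y = {}"
    proof -
      have "y i \<noteq> - y j" if "i < N" "j < N" for i j
        using ypos[OF that(1)] ypos[OF that(2)] by linarith
      then show ?thesis by auto
    qed
    then have "card (?Y \<union> uminus ` ?Y) = card ?Y + card (uminus ` ?Y)"
      by (intro card_Un_disjoint) auto
    then show "card ?I \<le> card (?Y \<union> uminus ` ?Y)"
      using card_image[OF inj_on_chamber[OF y]] by (simp add: card_image)
    show "(\<Sum>i\<in>?I. c i * exp (a i * z)) = 0" if z: "z \<in> ?Y \<union> uminus ` ?Y" for z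
    proof -
      from z obtain i where "i < N" "z = y i \<or> z = - y i" by auto
      then show ?thesis using E[of "y i"] row E_odd[of "y i"] by auto
    qed
  qed auto
  then have "w j = 0" if "j < N" for j using that by (auto simp: c_def)
  then have "v = 0\<^sub>v N" using v by (intro eq_vecI) (auto simp: w_def)
  with v show False by simp
qed

text \<open>The intermediate value theorem applies along the segment from \<open>y\<close> to
  \<open>z\<close>. The sign itself is never computed; comparing two points is enough for the
  integral.\<close>

lemma f_hat_same_sign:
  assumes t: "t > 0" and x: "x \<in> open_chamber N"
    and y: "y \<in> open_chamber N" and z: "z \<in> open_chamber N"
  shows "f_hat N t y x * f_hat N t z x > 0"
proof (rule ccontr)
  define \<phi> where "\<phi> u = f_hat N t (\<lambda>i. (1 - u) * y i + u * z i) x" for u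
  assume "\<not> ?thesis"
  then have sign: "\<phi> 0 * \<phi> 1 \<le> 0" by (simp add: \<phi>_def)
  have cont: "continuous_on {0..1} \<phi>"
    unfolding \<phi>_def[abs_def] f_hat_Leibniz absorbing_kernel_def
    by (intro continuous_intros) (use t in auto)
  have "(\<lambda>i. (1 - u) * y i + u * z i) \<in> open_chamber N" if "u \<in> {0..1}" for u
  proof -
    \<comment> \<open>Taking \<open>p = q = 0\<close> gives positivity of the coordinates; two
      coordinates of each point give their order.\<close>
    have convex: "(1 - u) * p + u * q < (1 - u) * p' + u * q'" if "p < p'" "q < q'" for p q p' q' :: real
    proof (cases "u = 0")
      case False
      then have "u * q < u * q'" "(1 - u) * p \<le> (1 - u) * p'"
        using \<open>u \<in> {0..1}\<close> that by (auto intro: mult_left_mono)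
      then show ?thesis by linarith
    qed (use that in simp)
    show ?thesis
      using y z convex[of 0 _ 0] convex by (auto simp: open_chamber_def strict_mono_on_def)
  qed
  then have nz: "\<phi> u \<noteq> 0" if "u \<in> {0..1}" for u
    using f_hat_nonzero[OF t x] that by (simp add: \<phi>_def)
  have "\<phi> 0 \<le> 0 \<and> 0 \<le> \<phi> 1 \<or> \<phi> 1 \<le> 0 \<and> 0 \<le> \<phi> 0"
    using sign by (auto simp: mult_le_0_iff)
  then obtain u where "0 \<le> u" "u \<le> 1" "\<phi> u = 0"
    using IVT'[of \<phi> 0 0 1] IVT2'[of \<phi> 1 0 0] cont by auto
  with nz show False by auto
qed

section \<open>Integrability of \<open>f_hat\<close> and nonvanishing of
  \<open>N_hat\<close>\<close>

lemma integrable_absorbing_kernel: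
  assumes "t > 0"
  shows "integrable lborel (absorbing_kernel t x)"
proof -
  have "absorbing_kernel t x = (\<lambda>y. normal_density x (sqrt t) y - normal_density (- x) (sqrt t) y)"
    using assms
    by (auto simp: absorbing_kernel_def normal_density_def powr_minus powr_half_sqrt
        field_simps power2_commute add.commute)
  then show ?thesis using assms by (simp add: integrable_normal_density)
qed

lemma integrable_f_hat:
  assumes "t > 0"
  shows "integrable (Pi\<^sub>M {..<N} (\<lambda>_. lborel)) (\<lambda>y. f_hat N t y x)"
proof -
  interpret product_sigma_finite "\<lambda>_ :: nat. lborel :: real measure" by standard
  show ?thesis
    unfolding f_hat_Leibniz
    by (intro Bochner_Integration.integrable_sum integrable_mult_right product_integrable_prod
        integrable_absorbing_kernel assms) auto
qed

text \<open>The product space contains only extensional functions, while \<open>chamber N\<close>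
  leaves values outside \<open>{..<N}\<close> free; hence the intersection.\<close>

lemma chamber_measurable:
  "chamber N \<inter> space (Pi\<^sub>M {..<N} (\<lambda>_. lborel)) \<in> sets (Pi\<^sub>M {..<N} (\<lambda>_. lborel))"
proof -
  have "chamber N \<inter> space (Pi\<^sub>M {..<N} (\<lambda>_. lborel)) =
    {x \<in> space (Pi\<^sub>M {..<N} (\<lambda>_. lborel)). (\<forall>i\<in>{..<N}. 0 \<le> x i) \<and>
      (\<forall>i\<in>{..<N}. \<forall>j\<in>{..<N}. i < j \<longrightarrow> x i < x j)}"
    by (auto simp: chamber_def strict_mono_on_def)
  also have "\<dots> \<in> sets (Pi\<^sub>M {..<N} (\<lambda>_. lborel))"
    by measurable
  finally show ?thesis .
qed

lemma N_hat_nonzero: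
  assumes t: "t \<ge> 0" and x: "x \<in> open_chamber N"
  shows "N_hat N t x \<noteq> 0"
proof (cases "t = 0")
  case False
  with t have t: "t > 0" by simp
  interpret product_sigma_finite "\<lambda>_ :: nat. lborel :: real measure" by standard
  let ?M = "Pi\<^sub>M {..<N} (\<lambda>_. lborel) :: (nat \<Rightarrow> real) measure"
  define y0 :: "nat \<Rightarrow> real" where "y0 i = real i + 1" for i
  have y0: "y0 \<in> open_chamber N" by (auto simp: y0_def open_chamber_def strict_mono_on_def)
  \<comment> \<open>The constant factor \<open>f_hat N t y0 x\<close> at a reference point cancels
    the unknown sign of the integrand.\<close>
  define G where "G y = f_hat N t y0 x * (indicator (chamber N) y * f_hat N t y x)" for y
  have [measurable]: "chamber N \<inter> space ?M \<in> sets ?M" by (rule chamber_measurable)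
  have "integrable ?M (\<lambda>y. indicator (chamber N \<inter> space ?M) y *\<^sub>R f_hat N t y x)"
    by (intro integrable_mult_indicator integrable_f_hat t chamber_measurable)
  then have "integrable ?M (\<lambda>y. indicator (chamber N) y * f_hat N t y x)"
    by (rule Bochner_Integration.integrable_cong[THEN iffD1, rotated -1]) (auto simp: indicator_def)
  then have intG: "integrable ?M G" unfolding G_def by simp
  have G_pos: "G y > 0" if "y \<in> open_chamber N" for y
  proof -
    have "y \<in> chamber N" using that by (auto simp: chamber_def open_chamber_def less_imp_le)
    then show ?thesis using f_hat_same_sign[OF t x y0 that] by (simp add: G_def)
  qed
  have G_nonneg: "G y \<ge> 0" for y
  proof (cases "y \<in> chamber N - open_chamber N")
    case True
    \<comment> \<open>The two chambers differ only by points with a zero coordinate, where the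
      kernel vanishes.\<close>
    then obtain i where i: "i < N" "y i = 0"
      by (auto simp: chamber_def open_chamber_def order_le_less)
    have "(\<Prod>i<N. absorbing_kernel t (x (p i)) (y i)) = 0" for p
      using i by (intro prod_zero) (auto intro!: bexI[of _ i] simp: absorbing_kernel_def)
    then have "f_hat N t y x = 0" by (simp only: f_hat_Leibniz mult_zero_right sum.neutral_const)
    then show ?thesis by (simp add: G_def)
  next
    case False
    then show ?thesis using G_pos[of y] by (cases "y \<in> chamber N") (auto simp: G_def)
  qed
  \<comment> \<open>Consecutive unit intervals force increasing coordinates, so this box of measure
    1 lies in the open chamber.\<close>
  let ?B = "PiE {..<N} (\<lambda>i. {real i <..< real i + 1})"
  have B: "?B \<subseteq> open_chamber N"
  proof
    fix y assume "y \<in> ?B"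
    then have b: "real i < y i" "y i < real i + 1" if "i < N" for i
      using that by (auto simp: PiE_iff)
    have "y i < y j" if "i < j" "j < N" for i j
      using b(2)[of i] b(1)[of j] that by linarith
    moreover have "0 < y i" if "i < N" for i using b(1)[OF that] by linarith
    ultimately show "y \<in> open_chamber N" by (auto simp: open_chamber_def strict_mono_on_def)
  qed
  have emB: "emeasure ?M ?B = 1"
    by (subst emeasure_PiM) auto
  have "integral\<^sup>L ?M G \<noteq> 0"
  proof
    assume "integral\<^sup>L ?M G = 0"
    then have "AE y in ?M. G y = 0"
      using integral_nonneg_eq_0_iff_AE[OF intG] G_nonneg by simp
    moreover have "y \<notin> ?B" if "G y = 0" for y
      using G_pos[of y] B that by auto
    ultimately have "AE y in ?M. y \<notin> ?B"
      by (rule eventually_mono)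
    moreover have "?B \<in> sets ?M" by (intro sets_PiM_I_finite) auto
    ultimately have "emeasure ?M ?B = 0"
      using AE_iff_null_sets by blast
    with emB show False by simp
  qed
  then have "N_hat N t x \<noteq> 0"
    using \<open>t \<noteq> 0\<close> unfolding G_def N_hat_def set_lebesgue_integral_def by auto
  then show ?thesis .
qed (simp add: N_hat_def)

section \<open>Constants and telescoping over the time steps\<close>

lemma h_hat_nonzero:
  assumes "x \<in> open_chamber N"
  shows "h_hat N x \<noteq> 0"
proof -
  have "(x j)\<^sup>2 - (x i)\<^sup>2 \<noteq> 0" if "i < j" "j < N" for i j
  proof -
    have "0 < x i" "x i < x j" using assms that by (auto simp: open_chamber_def strict_mono_on_def)
    then have "(x i)\<^sup>2 < (x j)\<^sup>2" by (intro power_strict_mono) auto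
    then show ?thesis by simp
  qed
  then show ?thesis using assms by (fastforce simp: h_hat_def open_chamber_def)
qed

text \<open>Converts the constant in the first step, the one that starts at the origin.\<close>

lemma c_tilde_mult_c_hat': "c_tilde N * c_hat' N = c_hat N"
proof -
  have "(\<Prod>j=1..N. Gamma (2 * real j)) \<noteq> 0"
    by (simp add: Gamma_real_pos less_imp_neq[symmetric])
  moreover have "(pi / 2) powr (real N / 2) * (2 / pi) powr (real N / 2) = 1"
    by (subst powr_mult[symmetric]) auto
  ultimately show ?thesis
    by (simp add: c_tilde_def c_hat'_def c_hat_def prod_dividef)
qed

theorem mainTheorem6:
  fixes N l :: nat and T :: real and t :: "nat \<Rightarrow> real" and y :: "nat \<Rightarrow> nat \<Rightarrow> real"
  assumes "N \<ge> 1" and "l \<ge> 1" and "T > 0"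
    and "t 0 = 0" and "\<forall>i<l. t i < t (Suc i)" and "t l = T"
    and "\<forall>k<N. y 0 k = 0"
    and "\<forall>i\<in>{1..l}. y i \<in> open_chamber N"
  shows "(\<Prod>i=1..l. g_hat N T (t (i - 1)) (y (i - 1)) (t i) (y i)) =
    c_tilde N * T powr ((real N)\<^sup>2 / 2) *
      (\<Prod>i=1..l. p_hat N (t (i - 1)) (y (i - 1)) (t i) (y i)) * (1 / h_hat N (y l))"
proof -
  have t_le: "t i \<le> T" if "i \<le> l" for i
    using that assms(5) unfolding assms(6)[symmetric]
    by (induction i rule: inc_induct) (auto intro: less_imp_le order_trans)
  define G where "G i = g_hat N T (t (i - 1)) (y (i - 1)) (t i) (y i)" for i
  define P where "P i = p_hat N (t (i - 1)) (y (i - 1)) (t i) (y i)" for i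
  \<comment> \<open>Away from the origin both densities are \<open>f_hat\<close> reweighted by a
    ratio, of \<open>N_hat\<close> values for \<open>g_hat\<close> and of \<open>h_hat\<close>
    values for \<open>p_hat\<close>; \<open>R\<close> is the quotient of the two weights.\<close>
  define R where "R i = N_hat N (T - t i) (y i) / h_hat N (y i)" for i
  define K where "K = c_tilde N * T powr ((real N)\<^sup>2 / 2)"
  \<comment> \<open>The induction starts at 1 because the step from the origin uses the other branch
    of the densities; it alone produces \<open>K\<close>.\<close>
  have "prod G {1..m} = K * prod P {1..m} * R m" if "1 \<le> m" "m \<le> l" for m
    using that
  proof (induction m rule: dec_induct)
    case base
    then have "h_hat N (y 1) \<noteq> 0" using assms(8) by (intro h_hat_nonzero) auto
    then show ?case
      using assms(4,7)
      by (simp add: G_def P_def R_def K_def g_hat_def p_hat_def c_tilde_mult_c_hat'[symmetric]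
          power2_eq_square)
  next
    case (step m)
    have ym: "y m \<in> open_chamber N" "y (Suc m) \<in> open_chamber N" using step assms(8) by auto
    then have "\<not> (t m = 0 \<and> (\<forall>i<N. y m i = 0))"
      using assms(1) by (force simp: open_chamber_def)
    then have "G (Suc m) = f_hat N (t (Suc m) - t m) (y (Suc m)) (y m) *
        N_hat N (T - t (Suc m)) (y (Suc m)) / N_hat N (T - t m) (y m)"
      and "P (Suc m) = 1 / h_hat N (y m) * f_hat N (t (Suc m) - t m) (y (Suc m)) (y m) *
        h_hat N (y (Suc m))"
      by (simp_all only: G_def P_def g_hat_def p_hat_def diff_Suc_1 if_False)
    moreover have "N_hat N (T - t m) (y m) \<noteq> 0"
      using ym step t_le[of m] by (intro N_hat_nonzero) auto
    ultimately have RG: "R m * G (Suc m) = P (Suc m) * R (Suc m)"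
      using h_hat_nonzero[OF ym(1)] h_hat_nonzero[OF ym(2)]
      by (simp add: R_def)
    have "prod G {1..Suc m} = K * prod P {1..m} * (R m * G (Suc m))"
      using step by simp
    also have "\<dots> = K * prod P {1..Suc m} * R (Suc m)"
      unfolding RG by simp
    finally show ?case .
  qed
  \<comment> \<open>At the final time \<open>T - t l = 0\<close>, so the convention
    \<open>N_hat N 0 x = 1\<close> turns \<open>R l\<close> into
    \<open>1 / h_hat N (y l)\<close>.\<close>
  from this[of l] assms(2,6) show ?thesis
    unfolding G_def P_def R_def K_def by (simp add: N_hat_def)
qed

end
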